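(* Let $\mathcal{H}$ be a complex Hilbert space and let $\mathbf{T}_0\preceq\mathbf{T}_1\preceq\mathbf{T}_2\preceq\cdots$ be a sequence of closed linear (possibly unbounded) operators $\mathbf{T}_k:\mathcal{D}_{\mathbf{T}_k}\subseteq\mathcal{H}\to\mathcal{H}$. Then $$\lim_{k\to\infty}\mathrm{SRG}(\mathbf{T}_k)=\bigcap_{\alpha\in\mathbb{R}}\ \lim_{k\to\infty}\mathrm{Ann}(\mathbf{T}_k,\alpha).$$
   Context: Let $\hat{\mathbb{C}}=\mathbb{C}\cup\{\infty\}$ be the extended complex plane with the chordal metric. For a sequence of subsets $S_k\subseteq\hat{\mathbb{C}}$, define $\lim_{k\to\infty}S_k=\{z\in\hat{\mathbb{C}}: z=\lim_{k\to\infty}z_k \text{ for some } z_k\in S_k\}$. A linear (possibly unbounded) operator $\mathbf{T}:\mathcal{D}_{\mathbf{T}}\subseteq\mathcal{H}\to\mathcal{H}$ is a linear map whose domain $\mathcal{D}_{\mathbf{T}}$ is a linear subspace of $\mathcal{H}$ (not necessarily dense or closed). Its graph is $\mathcal{G}_{\mathbf{T}}=\{(u,\mathbf{T}u):u\in\mathcal{D}_{\mathbf{T}}\}\subseteq\mathcal{H}\times\mathcal{H}$, and $\mathbf{T}$ is closed if $\mathcal{G}_{\mathbf{T}}$ is closed in $\mathcal{H}\times\mathcal{H}$. Write $\mathbf{T}_1\preceq\mathbf{T}_2$ if $\mathcal{G}_{\mathbf{T}_1}\subseteq\mathcal{G}_{\mathbf{T}_2}$. $\mathbf{I}$ is the identity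 operator. The Scaled Relative Graph of $\mathbf{T}$ is $$\mathrm{SRG}(\mathbf{T})=\left\{\frac{\|y\|}{\|u\|}\exp(\pm i\angle(u,y)):u\in\mathcal{D}_{\mathbf{T}}\setminus\{0\},\ y=\mathbf{T}u\right\}\subseteq\hat{\mathbb{C}},$$ where $\angle(u,y)\in[0,\pi]$ is defined by $\cos\angle(u,y)=\frac{\mathrm{Re}\langle y,u\rangle}{\|y\|\|u\|}$ if $y\neq0$, and $\angle(u,y)=0$ if $y=0$. The maximum and minimum gains are $$\bar\sigma(\mathbf{T})=\sup_{u\in\mathcal{D}_{\mathbf{T}},\,u\ne0}\frac{\|\mathbf{T}u\|}{\|u\|},\qquad \underline{\sigma}(\mathbf{T})=\inf_{u\in\mathcal{D}_{\mathbf{T}},\,u\ne0}\frac{\|\mathbf{T}u\|}{\|u\|},$$ and for $\alpha\in\mathbb{R}$ the annulus of $\mathbf{T}$ is $$\mathrm{Ann}(\mathbf{T},\alpha)=\{\alpha+z:\underline{\sigma}(\mathbf{T}-\alpha\mathbf{I})\le|z|\le\bar\sigma(\mathbf{T}-\alpha\mathbf{I})\}\subseteq\hat{\mathbb{C}},$$ where $\mathbf{T}-\alpha\mathbf{I}$ has domain $\mathcal{D}_{\mathbf{T}}$. By convention $\infty\in\mathrm{Ann}(\mathbf{T},\alpha)$ if $\bar\sigma(\mathbf{T}-\alpha\mathbf{I})=\infty$, and $\mathrm{Ann}(\mathbf{T},\alpha)=\{\infty\}$ if both gains are $\infty$. *)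

theory Defs
  imports "HOL-Analysis.Analysis"
begin

section \<open>Complex Hilbert spaces\<close>

class complex_vector = real_vector +
  fixes scaleC :: "complex \<Rightarrow> 'a \<Rightarrow> 'a" (infixr "*\<^sub>C" 75)
  assumes scaleC_add_right: "a *\<^sub>C (x + y) = a *\<^sub>C x + a *\<^sub>C y"
    and scaleC_add_left: "(a + b) *\<^sub>C x = a *\<^sub>C x + b *\<^sub>C x"
    and scaleC_scaleC: "a *\<^sub>C (b *\<^sub>C x) = (a * b) *\<^sub>C x"
    and scaleC_one: "1 *\<^sub>C x = x"
    and scaleR_scaleC: "r *\<^sub>R x = complex_of_real r *\<^sub>C x"

interpretation complex_vector:
  vector_space "scaleC :: complex \<Rightarrow> 'a::complex_vector \<Rightarrow> 'a"
  by unfold_locales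
    (simp_all add: scaleC_add_right scaleC_add_left scaleC_scaleC scaleC_one)

text \<open>The inner product is linear in its first argument.\<close>

class complex_inner = complex_vector + real_normed_vector +
  fixes cinner :: "'a \<Rightarrow> 'a \<Rightarrow> complex"
  assumes cinner_commute: "cinner x y = cnj (cinner y x)"
    and cinner_add_left: "cinner (x + y) z = cinner x z + cinner y z"
    and cinner_scaleC_left: "cinner (a *\<^sub>C x) y = a * cinner x y"
    and cinner_ge_zero: "0 \<le> Re (cinner x x)"
    and cinner_eq_zero_iff: "cinner x x = 0 \<longleftrightarrow> x = 0"
    and norm_eq_sqrt_cinner: "norm x = sqrt (Re (cinner x x))"

class complex_hilbert_space = complex_inner + complete_space

instantiation complex :: complex_hilbert_space
begin

definition scaleC_complex :: "complex \<Rightarrow> complex \<Rightarrow> complex"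
  where "scaleC_complex a x = a * x"

definition cinner_complex :: "complex \<Rightarrow> complex \<Rightarrow> complex"
  where "cinner_complex x y = x * cnj y"

instance
proof
  fix a b x y z :: complex and r :: real
  show "a *\<^sub>C (x + y) = a *\<^sub>C x + a *\<^sub>C y"
    and "(a + b) *\<^sub>C x = a *\<^sub>C x + b *\<^sub>C x"
    and "a *\<^sub>C (b *\<^sub>C x) = (a * b) *\<^sub>C x"
    and "1 *\<^sub>C x = x"
    by (simp_all add: scaleC_complex_def distrib_left distrib_right mult.assoc)
  show "r *\<^sub>R x = complex_of_real r *\<^sub>C x"
    by (simp only: scaleC_complex_def scaleR_conv_of_real)
  show "cinner x y = cnj (cinner y x)"
    by (simp add: cinner_complex_def)
  show "cinner (x + y) z = cinner x z + cinner y z"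
    by (simp add: cinner_complex_def distrib_right)
  show "cinner (a *\<^sub>C x) y = a * cinner x y"
    by (simp add: cinner_complex_def scaleC_complex_def mult.assoc)
  have Re: "Re (cinner x x) = (cmod x)\<^sup>2"
    by (simp only: cinner_complex_def complex_norm_square[symmetric] Re_complex_of_real)
  show "0 \<le> Re (cinner x x)"
    by (simp only: Re zero_le_power2)
  show "cinner x x = 0 \<longleftrightarrow> x = 0"
    by (simp add: cinner_complex_def)
  show "norm x = sqrt (Re (cinner x x))"
    by (simp only: Re real_sqrt_abs abs_norm_cancel)
qed

end


section \<open>The extended complex plane\<close>

datatype ext_complex = Finite complex | Infinity

text \<open>The stereographic projection onto the unit sphere in \<open>\<complex> \<times> \<real>\<close>; it is used only to
  establish the triangle inequality for the chordal metric.\<close>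

primrec stereo :: "ext_complex \<Rightarrow> complex \<times> real" where
  "stereo (Finite z) =
     ((2 / (1 + (cmod z)\<^sup>2)) *\<^sub>R z, ((cmod z)\<^sup>2 - 1) / (1 + (cmod z)\<^sup>2))"
| "stereo Infinity = (0, 1)"

fun chordal_dist :: "ext_complex \<Rightarrow> ext_complex \<Rightarrow> real" where
  "chordal_dist (Finite z) (Finite w) =
     2 * cmod (z - w) / (sqrt (1 + (cmod z)\<^sup>2) * sqrt (1 + (cmod w)\<^sup>2))"
| "chordal_dist (Finite z) Infinity = 2 / sqrt (1 + (cmod z)\<^sup>2)"
| "chordal_dist Infinity (Finite w) = 2 / sqrt (1 + (cmod w)\<^sup>2)"
| "chordal_dist Infinity Infinity = 0"

lemma one_plus_sq_pos: "0 < 1 + (x::real)\<^sup>2"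
  by (simp add: add_pos_nonneg)

lemma dist_stereo_Finite_Infinity:
  "dist (stereo (Finite z)) (stereo Infinity) = 2 / sqrt (1 + (cmod z)\<^sup>2)"
proof -
  define p where "p = 1 + (cmod z)\<^sup>2"
  have p: "p > 0" "(cmod z)\<^sup>2 = p - 1"
    using one_plus_sq_pos[of "cmod z"] by (auto simp: p_def)
  have "(dist (stereo (Finite z)) (stereo Infinity))\<^sup>2 =
      (cmod ((2 / p) *\<^sub>R z))\<^sup>2 + ((p - 2) / p - 1)\<^sup>2"
    using p by (simp add: dist_prod_def dist_norm p_def[symmetric]
        power2_commute[of 1] del: norm_scaleR)
  also have "(cmod ((2 / p) *\<^sub>R z))\<^sup>2 = (2 / p)\<^sup>2 * (p - 1)"
    using p by (simp add: power_mult_distrib power_divide)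
  also have "\<dots> + ((p - 2) / p - 1)\<^sup>2 = 4 / p\<^sup>2 * (p - 1) + 4 / p\<^sup>2"
    using p by (simp add: power_mult_distrib power_divide field_simps power2_eq_square)
  also have "\<dots> = (2 / sqrt p)\<^sup>2"
    using p by (simp add: power_divide field_simps power2_eq_square)
  finally have "dist (stereo (Finite z)) (stereo Infinity) = 2 / sqrt p"
    using p by (simp add: power2_eq_iff_nonneg)
  then show ?thesis by (simp add: p_def)
qed

lemma power2_norm_scaleR_diff:
  fixes z w :: "'a::real_inner"
  shows "(norm (a *\<^sub>R z - b *\<^sub>R w))\<^sup>2 =
    a\<^sup>2 * (z \<bullet> z) + b\<^sup>2 * (w \<bullet> w) - 2 * a * b * (z \<bullet> w)"
  unfolding power2_norm_eq_inner
  by (simp add: inner_diff_left inner_diff_right inner_commute[of w z] power2_eq_square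
      algebra_simps)

lemma dist_stereo_Finite_Finite:
  "dist (stereo (Finite z)) (stereo (Finite w)) =
     2 * cmod (z - w) / (sqrt (1 + (cmod z)\<^sup>2) * sqrt (1 + (cmod w)\<^sup>2))"
proof -
  define p where "p = 1 + (cmod z)\<^sup>2"
  define q where "q = 1 + (cmod w)\<^sup>2"
  define c where "c = z \<bullet> w"
  have p: "p > 0" "(cmod z)\<^sup>2 = p - 1" "z \<bullet> z = p - 1"
    using one_plus_sq_pos[of "cmod z"] by (auto simp: p_def dot_square_norm)
  have q: "q > 0" "(cmod w)\<^sup>2 = q - 1" "w \<bullet> w = q - 1"
    using one_plus_sq_pos[of "cmod w"] by (auto simp: q_def dot_square_norm)
  have "(dist (stereo (Finite z)) (stereo (Finite w)))\<^sup>2 =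
      (cmod ((2 / p) *\<^sub>R z - (2 / q) *\<^sub>R w))\<^sup>2 + ((p - 2) / p - (q - 2) / q)\<^sup>2"
    using p q by (simp add: dist_prod_def dist_norm p_def[symmetric] q_def[symmetric])
  also have "(cmod ((2 / p) *\<^sub>R z - (2 / q) *\<^sub>R w))\<^sup>2 =
      (2 / p)\<^sup>2 * (z \<bullet> z) + (2 / q)\<^sup>2 * (w \<bullet> w) - 2 * (2 / p) * (2 / q) * c"
    unfolding c_def by (rule power2_norm_scaleR_diff)
  also have "\<dots> = 4 / p\<^sup>2 * (p - 1) + 4 / q\<^sup>2 * (q - 1) - 8 / (p * q) * c"
    unfolding p(3) q(3) by (simp add: power_divide)
  also have "\<dots> + ((p - 2) / p - (q - 2) / q)\<^sup>2 = 4 * ((p - 1) + (q - 1) - 2 * c) / (p * q)"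
    using p q by (simp add: field_simps power2_eq_square)
  also have "(p - 1) + (q - 1) - 2 * c = (cmod (z - w))\<^sup>2"
    using p q unfolding power2_norm_eq_inner
    by (simp add: inner_diff_left inner_diff_right inner_commute[of w z] c_def[symmetric])
  also have "4 * (cmod (z - w))\<^sup>2 / (p * q) = (2 * cmod (z - w) / (sqrt p * sqrt q))\<^sup>2"
    using p q by (simp add: power_divide power_mult_distrib)
  finally have "dist (stereo (Finite z)) (stereo (Finite w)) =
      2 * cmod (z - w) / (sqrt p * sqrt q)"
    using p q by (subst (asm) power2_eq_iff_nonneg) auto
  then show ?thesis by (simp add: p_def q_def)
qed

lemma chordal_dist_eq_dist_stereo: "chordal_dist x y = dist (stereo x) (stereo y)"
proof (cases x; cases y)
  fix z w assume "x = Finite z" "y = Finite w"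
  then show ?thesis using dist_stereo_Finite_Finite by simp
next
  fix z assume "x = Finite z" "y = Infinity"
  then show ?thesis using dist_stereo_Finite_Infinity by simp
next
  fix w assume "x = Infinity" "y = Finite w"
  then show ?thesis using dist_stereo_Finite_Infinity[of w] by (simp add: dist_commute)
qed simp

lemma chordal_dist_eq_0_iff: "chordal_dist x y = 0 \<longleftrightarrow> x = y"
proof -
  have "sqrt (1 + (cmod z)\<^sup>2) \<noteq> 0" for z
    using one_plus_sq_pos[of "cmod z"] by (metis less_irrefl real_sqrt_eq_zero_cancel_iff)
  then show ?thesis by (cases x; cases y) (simp_all del: real_sqrt_eq_zero_cancel_iff)
qed

instantiation ext_complex :: metric_space
begin

definition dist_ext_complex :: "ext_complex \<Rightarrow> ext_complex \<Rightarrow> real"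
  where "dist_ext_complex = chordal_dist"

definition uniformity_ext_complex :: "(ext_complex \<times> ext_complex) filter"
  where "uniformity_ext_complex = (INF e\<in>{0<..}. principal {(x, y). dist x y < e})"

definition open_ext_complex :: "ext_complex set \<Rightarrow> bool"
  where "open_ext_complex U \<longleftrightarrow>
    (\<forall>x\<in>U. eventually (\<lambda>(x', y). x' = x \<longrightarrow> y \<in> U) uniformity)"

instance
proof
  fix x y z :: ext_complex
  show "dist x y = 0 \<longleftrightarrow> x = y"
    by (simp add: dist_ext_complex_def chordal_dist_eq_0_iff)
  show "dist x y \<le> dist x z + dist y z"
    by (simp add: dist_ext_complex_def chordal_dist_eq_dist_stereo dist_triangle2)
qed (simp_all add: uniformity_ext_complex_def open_ext_complex_def)

end

text \<open>Every \<open>S k\<close> has to be nonempty for this limit to be nonempty.\<close>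

definition set_lim :: "(nat \<Rightarrow> ext_complex set) \<Rightarrow> ext_complex set"
  where "set_lim S = {z. \<exists>x. (\<forall>k. x k \<in> S k) \<and> x \<longlonglongrightarrow> z}"


section \<open>Unbounded operators\<close>

text \<open>An operator is given by its domain \<open>D\<close> together with a function \<open>T\<close> whose values
  outside \<open>D\<close> are never used.\<close>

definition linear_operator :: "'a::complex_vector set \<Rightarrow> ('a \<Rightarrow> 'a) \<Rightarrow> bool"
  where "linear_operator D T \<longleftrightarrow>
    complex_vector.subspace D \<and>
    (\<forall>u\<in>D. \<forall>v\<in>D. T (u + v) = T u + T v) \<and>
    (\<forall>c. \<forall>u\<in>D. T (c *\<^sub>C u) = c *\<^sub>C T u)"

definition op_graph :: "'a set \<Rightarrow> ('a \<Rightarrow> 'a) \<Rightarrow> ('a \<times> 'a) set"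
  where "op_graph D T = {(u, T u) | u. u \<in> D}"

definition closed_operator :: "'a::complex_inner set \<Rightarrow> ('a \<Rightarrow> 'a) \<Rightarrow> bool"
  where "closed_operator D T \<longleftrightarrow> closed (op_graph D T)"


section \<open>Scaled relative graph and annuli\<close>

definition angle :: "'a::complex_inner \<Rightarrow> 'a \<Rightarrow> real"
  where "angle u y =
    (if y = 0 then 0 else arccos (Re (cinner y u) / (norm y * norm u)))"

definition SRG :: "'a::complex_inner set \<Rightarrow> ('a \<Rightarrow> 'a) \<Rightarrow> ext_complex set"
  where "SRG D T =
    {Finite (complex_of_real (norm (T u) / norm u) *
        exp (s * \<i> * complex_of_real (angle u (T u)))) | u s.
      u \<in> D - {0} \<and> s \<in> {1, -1}}"

text \<open>The gains take values in \<open>[0, \<infinity>]\<close>: on the trivial domain the supremum is \<open>0\<close> and the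
  infimum is \<open>\<infinity>\<close>.\<close>

definition max_gain :: "'a::complex_inner set \<Rightarrow> ('a \<Rightarrow> 'a) \<Rightarrow> ennreal"
  where "max_gain D T = (SUP u\<in>D - {0}. ennreal (norm (T u) / norm u))"

definition min_gain :: "'a::complex_inner set \<Rightarrow> ('a \<Rightarrow> 'a) \<Rightarrow> ennreal"
  where "min_gain D T = (INF u\<in>D - {0}. ennreal (norm (T u) / norm u))"

text \<open>If both gains are \<open>\<infinity>\<close>, no finite point satisfies the inequalities and the annulus
  is \<open>{\<infinity>}\<close>.\<close>

definition Ann :: "'a::complex_inner set \<Rightarrow> ('a \<Rightarrow> 'a) \<Rightarrow> real \<Rightarrow> ext_complex set"
  where "Ann D T \<alpha> =
    (let T\<^sub>\<alpha> = (\<lambda>u. T u - \<alpha> *\<^sub>R u) in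
      {Finite (complex_of_real \<alpha> + z) | z.
        min_gain D T\<^sub>\<alpha> \<le> ennreal (cmod z) \<and> ennreal (cmod z) \<le> max_gain D T\<^sub>\<alpha>} \<union>
      (if max_gain D T\<^sub>\<alpha> = \<infinity> then {Infinity} else {}))"

end

theory Submission
  imports Defs
begin

text \<open>A point \<open>z\<close> lies in the scaled relative graph of \<open>T\<close> iff \<open>(Re z, |z|\<^sup>2)\<close> lies in the joint
  numerical range \<open>W\<close> of the two Hermitian forms \<open>Re \<langle>Tu,u\<rangle>\<close> and \<open>\<parallel>Tu\<parallel>\<^sup>2\<close>, and \<open>W\<close> is convex by the
  Toeplitz--Hausdorff theorem. Since \<open>|z - \<alpha>|\<^sup>2 = |z|\<^sup>2 - 2\<alpha> Re z + \<alpha>\<^sup>2\<close>, the annulus at \<open>\<alpha>\<close> is the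
  strip between the two supporting lines of \<open>W\<close> with normal \<open>(-2\<alpha>, 1)\<close>. A point outside the closure
  of \<open>W\<close> can be separated from it by a line, which can be tilted to be non-vertical because
  \<open>\<parallel>Tu\<parallel>\<^sup>2 \<ge> 0\<close>; hence some annulus excludes it. For an increasing sequence of operators the sets
  \<open>W\<close> increase, so their union is still convex, and the limit of the scaled relative graphs is the
  closure of their union.\<close>

section \<open>Complex inner products\<close>

lemma cinner_add_right: "cinner x (y + z) = cinner x y + cinner x z"
  by (metis cinner_add_left cinner_commute complex_cnj_add)

lemma cinner_scaleC_right: "cinner x (a *\<^sub>C y) = cnj a * cinner x y"
  by (metis cinner_commute cinner_scaleC_left complex_cnj_mult)

lemma cinner_zero_left [simp]: "cinner 0 x = 0"
  using cinner_scaleC_left[of 0 0 x] by (simp add: complex_vector.scale_zero_left)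

lemma Im_cinner_self [simp]: "Im (cinner x x) = 0"
  by (metis Reals_cnj_iff cinner_commute complex_is_Real_iff)

lemma cinner_self: "cinner x x = of_real ((norm x)\<^sup>2)"
  by (simp add: complex_eq_iff norm_eq_sqrt_cinner cinner_ge_zero)

lemma norm_scaleC: "norm (a *\<^sub>C x) = cmod a * norm (x :: 'a::complex_inner)"
proof -
  have "of_real ((norm (a *\<^sub>C x))\<^sup>2) = a * cnj a * cinner x x"
    by (simp only: cinner_self[symmetric] cinner_scaleC_left cinner_scaleC_right mult.assoc
        mult.left_commute)
  also have "\<dots> = of_real ((cmod a * norm x)\<^sup>2)"
    by (simp add: cinner_self complex_norm_square[symmetric] power_mult_distrib)
  finally have "(norm (a *\<^sub>C x))\<^sup>2 = (cmod a * norm x)\<^sup>2"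
    unfolding of_real_eq_iff .
  then show ?thesis by (simp add: power2_eq_iff_nonneg)
qed

text \<open>This expansion yields Cauchy-Schwarz and makes the squared gain of T - \<alpha> I at a
  unit vector affine in \<open>Re (cinner (T u) u)\<close> and
  \<open>(norm (T u))\<^sup>2\<close>.\<close>

lemma power2_norm_diff_scaleR:
  fixes x y :: "'a::complex_inner"
  shows "(norm (y - a *\<^sub>R x))\<^sup>2 = (norm y)\<^sup>2 - 2 * a * Re (cinner y x) + a\<^sup>2 * (norm x)\<^sup>2"
proof -
  have *: "y - a *\<^sub>R x = y + of_real (- a) *\<^sub>C x"
    by (simp add: scaleR_scaleC[symmetric])
  have "Re (cinner x y) = Re (cinner y x)"
    by (subst cinner_commute) simp
  then have "Re (cinner (y - a *\<^sub>R x) (y - a *\<^sub>R x)) =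
      Re (cinner y y) - 2 * a * Re (cinner y x) + a\<^sup>2 * Re (cinner x x)"
    unfolding * cinner_add_left cinner_add_right cinner_scaleC_left cinner_scaleC_right
    by (simp add: power2_eq_square algebra_simps)
  then show ?thesis by (simp add: cinner_self)
qed

lemma abs_Re_cinner_le: "\<bar>Re (cinner y x)\<bar> \<le> norm y * norm (x :: 'a::complex_inner)"
proof (cases "x = 0")
  case True
  then show ?thesis by (subst cinner_commute) simp
next
  case False
  define r where "r = Re (cinner y x)"
  \<comment> \<open>The coefficient is that of the real multiple of \<open>x\<close> nearest to
    \<open>y\<close>.\<close>
  have "0 \<le> (norm (y - (r / (norm x)\<^sup>2) *\<^sub>R x))\<^sup>2" by simp
  also have "\<dots> = (norm y)\<^sup>2 - r\<^sup>2 / (norm x)\<^sup>2"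
    unfolding power2_norm_diff_scaleR r_def[symmetric]
    using False by (simp add: field_simps power2_eq_square)
  finally have "r\<^sup>2 \<le> (norm y * norm x)\<^sup>2"
    using False by (simp add: field_simps power_mult_distrib)
  then have "\<bar>r\<bar> \<le> \<bar>norm y * norm x\<bar>" by (simp only: abs_le_square_iff)
  then show ?thesis by (simp add: r_def)
qed

section \<open>The Toeplitz--Hausdorff theorem\<close>

text \<open>Conjugating the first term turns the imaginary part into \<open>Im (c * d)\<close> with
  \<open>d = b - cnj a\<close>; a unimodular \<open>c\<close> rotates \<open>d\<close> onto the real
  axis.\<close>

lemma phase_makes_real:
  obtains c where "cmod c = 1" "Im (cnj c * a + c * b) = 0"
proof (cases "b = cnj a")
  case True
  then show ?thesis by (intro that[of 1]) simp_all
next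
  case False
  define d where "d = b - cnj a"
  have d: "d \<noteq> 0" using False by (simp add: d_def)
  define c where "c = cnj d / cmod d"
  have "Im (cnj c * a + c * b) = Im (c * d)"
    by (simp add: d_def algebra_simps)
  also have "c * d = of_real (cmod d)"
    using d by (simp add: c_def mult.commute[of "cnj d"] complex_norm_square[symmetric] power2_eq_square)
  finally show ?thesis using d by (intro that[of c]) (simp_all add: c_def norm_divide)
qed

text \<open>The real and imaginary parts of \<open>B u u\<close> are two Hermitian forms, so this
  treats both at once. A point between two values is attained already in the span of the two
  vectors, by the intermediate value theorem.\<close>

lemma convex_numerical_range:
  fixes B :: "'a::complex_inner \<Rightarrow> 'a \<Rightarrow> complex"
  assumes D: "complex_vector.subspace D"
    and addl: "\<And>u v w. u \<in> D \<Longrightarrow> v \<in> D \<Longrightarrow> w \<in> D \<Longrightarrow> B (u + v) w = B u w + B v w"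
    and addr: "\<And>u v w. u \<in> D \<Longrightarrow> v \<in> D \<Longrightarrow> w \<in> D \<Longrightarrow> B w (u + v) = B w u + B w v"
    and scl: "\<And>c u v. u \<in> D \<Longrightarrow> v \<in> D \<Longrightarrow> B (c *\<^sub>C u) v = c * B u v"
    and scr: "\<And>c u v. u \<in> D \<Longrightarrow> v \<in> D \<Longrightarrow> B u (c *\<^sub>C v) = cnj c * B u v"
  shows "convex {B u u | u. u \<in> D \<and> norm u = 1}"
  unfolding convex_alt
proof safe
  fix x y and t :: real
  assume x: "x \<in> D" "norm x = 1" and y: "y \<in> D" "norm y = 1" and t: "0 \<le> t" "t \<le> 1"
  note memI = complex_vector.subspace_add[OF D] complex_vector.subspace_scale[OF D]
  show "\<exists>u. (1 - t) *\<^sub>R B x x + t *\<^sub>R B y y = B u u \<and> u \<in> D \<and> norm u = 1"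
  proof (cases "B x x = B y y")
    case True
    then show ?thesis using x by (intro exI[of _ x]) (simp add: algebra_simps)
  next
    case False
    define d where "d = B y y - B x x"
    define p where "p = B x x"
    \<comment> \<open>On unit vectors \<open>C u u\<close> is the affine image of
      \<open>B u u\<close> that sends the endpoints to 0 and 1, so the target becomes the real
      number \<open>t\<close>.\<close>
    define C where "C u v = (B u v - p * cinner u v) / d" for u v
    have d: "d \<noteq> 0" using False by (simp add: d_def)
    have Cadd: "C (u + v) w = C u w + C v w" "C w (u + v) = C w u + C w v"
      if "u \<in> D" "v \<in> D" "w \<in> D" for u v w
      using that by (simp_all add: C_def addl addr cinner_add_left cinner_add_right
          add_divide_distrib[symmetric] ring_distribs)
    have Cscale: "C (a *\<^sub>C u) v = a * C u v" "C u (a *\<^sub>C v) = cnj a * C u v"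
      if "u \<in> D" "v \<in> D" for a u v
      using that by (simp_all add: C_def scl scr cinner_scaleC_left cinner_scaleC_right
          right_diff_distrib mult.left_commute)
    have Cx: "C x x = 0" and Cy: "C y y = 1"
      using x y d by (simp_all add: C_def cinner_self d_def p_def)
    \<comment> \<open>Rotating \<open>y\<close> to make the cross terms real keeps \<open>C\<close> real on the segment from \<open>x\<close> to \<open>z\<close>, so
      that the intermediate value theorem applies.\<close>
    obtain c where c: "cmod c = 1" "Im (cnj c * C x y + c * C y x) = 0"
      by (rule phase_makes_real)
    define z where "z = c *\<^sub>C y"
    have z: "z \<in> D" using memI y by (simp add: z_def)
    define k where "k = Re (C x z + C z x)"
    have cross: "C x z + C z x = of_real k"
      using c x y by (simp add: k_def z_def Cscale complex_eq_iff)
    have "cnj c * c = 1"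
      using c(1) complex_norm_square[of c] by (simp add: mult.commute)
    then have Cz: "C z z = 1"
      using y by (simp add: z_def Cscale memI Cy)
    define w where "w s = (1 - s) *\<^sub>R x + s *\<^sub>R z" for s :: real
    define g where "g s = s * (1 - s) * k + s\<^sup>2" for s
    have w_alt: "w s = of_real (1 - s) *\<^sub>C x + of_real s *\<^sub>C z" for s
      by (simp only: w_def scaleR_scaleC)
    have w: "w s \<in> D" for s
      unfolding w_alt using memI x z by blast
    have expand: "C (of_real a *\<^sub>C x + of_real b *\<^sub>C z) (of_real a *\<^sub>C x + of_real b *\<^sub>C z) =
        of_real (a\<^sup>2) * C x x + of_real (a * b) * (C x z + C z x) + of_real (b\<^sup>2) * C z z" for a b
      using x z by (simp add: Cadd Cscale memI power2_eq_square algebra_simps)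
    have Cw: "C (w s) (w s) = of_real (g s)" for s
    proof -
      have "C (w s) (w s) = of_real ((1 - s)\<^sup>2) * C x x + of_real (s * (1 - s)) * (C x z + C z x)
          + of_real (s\<^sup>2) * C z z"
        unfolding w_alt expand by (simp only: mult.commute)
      also have "\<dots> = of_real (g s)" by (simp only: Cx cross Cz g_def of_real_add of_real_mult) simp
      finally show ?thesis .
    qed
    \<comment> \<open>A zero at \<open>s = 0\<close> would give \<open>x = 0\<close>; any other
      would make \<open>z\<close> a multiple of \<open>x\<close>, forcing \<open>C z z = 0\<close>
      because \<open>C x x = 0\<close>.\<close>
    have w_nz: "w s \<noteq> 0" for s
    proof
      assume 0: "w s = 0"
      show False
      proof (cases "s = 0")
        case True
        then show False using 0 x by (auto simp: w_def)
      next
        case False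
        have "z = (1 / s) *\<^sub>R (w s - (1 - s) *\<^sub>R x)" using False by (simp add: w_def)
        also have "\<dots> = (- (1 - s) / s) *\<^sub>R x"
          unfolding 0 by (simp flip: scaleR_minus_left minus_divide_left)
        also have "\<dots> = of_real (- (1 - s) / s) *\<^sub>C x" by (rule scaleR_scaleC)
        finally have "C z z = 0" using x by (simp add: Cscale memI Cx)
        then show False using Cz by simp
      qed
    qed
    \<comment> \<open>The quotient is the value of \<open>C\<close> at the normalised
      \<open>w s\<close>; it runs from 0 at \<open>x\<close> to 1 at \<open>z\<close>.\<close>
    have "\<exists>s. 0 \<le> s \<and> s \<le> 1 \<and> g s / (norm (w s))\<^sup>2 = t"
    proof (rule IVT')
      have "norm (w 1) = 1" using c y by (simp add: w_def z_def norm_scaleC)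
      then show "t \<le> g 1 / (norm (w 1))\<^sup>2" using t by (simp add: g_def)
      show "continuous_on {0..1} (\<lambda>s. g s / (norm (w s))\<^sup>2)"
        using w_nz unfolding g_def by (auto simp: w_def intro!: continuous_intros)
    qed (use t in \<open>simp_all add: g_def\<close>)
    then obtain s where s: "g s / (norm (w s))\<^sup>2 = t" by blast
    define u where "u = of_real (1 / norm (w s)) *\<^sub>C w s"
    have u: "u \<in> D" "norm u = 1"
      using w w_nz[of s] memI by (simp_all add: u_def norm_scaleC norm_divide)
    have "C u u = of_real (1 / norm (w s) * (1 / norm (w s)) * g s)"
      using w[of s] by (simp add: u_def Cscale memI Cw)
    also have "\<dots> = of_real t" using s by (simp add: power2_eq_square)
    finally have "B u u - p = of_real t * d"
      using d u by (simp add: C_def cinner_self divide_eq_eq)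
    then have "B u u = (1 - t) *\<^sub>R B x x + t *\<^sub>R B y y"
      by (simp add: scaleR_conv_of_real d_def p_def algebra_simps)
    then show ?thesis using u by metis
  qed
qed

text \<open>Packing the pair into one complex number makes it the diagonal of a single sesquilinear
  form.\<close>

definition moment :: "('a::complex_inner \<Rightarrow> 'a) \<Rightarrow> 'a \<Rightarrow> complex"
  where "moment T u = Complex (Re (cinner (T u) u)) ((norm (T u))\<^sup>2)"

definition moment_range :: "'a::complex_inner set \<Rightarrow> ('a \<Rightarrow> 'a) \<Rightarrow> complex set"
  where "moment_range D T = {moment T u | u. u \<in> D \<and> norm u = 1}"

lemma convex_moment_range:
  assumes "linear_operator D T"
  shows "convex (moment_range D T)"
proof -
  have D: "complex_vector.subspace D"
    and T: "\<And>u v. u \<in> D \<Longrightarrow> v \<in> D \<Longrightarrow> T (u + v) = T u + T v"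
      "\<And>c u. u \<in> D \<Longrightarrow> T (c *\<^sub>C u) = c *\<^sub>C T u"
    using assms by (auto simp: linear_operator_def)
  \<comment> \<open>The first summand is the Hermitian part of \<open>cinner (T u) v\<close>, hence
    real on the diagonal, so the two summands do not mix there.\<close>
  define B where
    "B u v = (cinner (T u) v + cinner u (T v)) / 2 + \<i> * cinner (T u) (T v)" for u v
  have "Re (cinner u (T u)) = Re (cinner (T u) u)" "Im (cinner u (T u)) = - Im (cinner (T u) u)" for u
    by (subst cinner_commute, simp)+
  then have "moment T u = B u u" for u
    by (simp add: moment_def B_def complex_eq_iff cinner_self)
  moreover have "convex {B u u | u. u \<in> D \<and> norm u = 1}"
    by (rule convex_numerical_range[OF D])
      (simp_all add: B_def T cinner_add_left cinner_add_right cinner_scaleC_left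
        cinner_scaleC_right field_simps)
  ultimately show ?thesis by (simp add: moment_range_def)
qed

section \<open>Scaled relative graphs and annuli\<close>

text \<open>For unit \<open>u\<close> these formulas recover \<open>z\<close> from the moment of
  \<open>u\<close> and the sign \<open>s\<close>, which selects the half-plane.\<close>

lemma SRG_point:
  fixes u y :: "'a::complex_inner"
  assumes "u \<noteq> 0" "s \<in> {1, - 1 :: complex}"
  defines "z \<equiv> of_real (norm y / norm u) * exp (s * \<i> * of_real (angle u y))"
  shows "Re z = Re (cinner y u) / (norm u)\<^sup>2" "cmod z = norm y / norm u"
    "Im z = Re s * sqrt ((norm y)\<^sup>2 / (norm u)\<^sup>2 - (Re z)\<^sup>2)"
proof -
  obtain r where s: "s = of_real r" "r = 1 \<or> r = -1"
    using assms(2) by (metis insertE of_real_1 of_real_minus singletonD)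
  have "s * \<i> * of_real (angle u y) = \<i> * of_real (r * angle u y)"
    by (simp add: s)
  then have z: "z = of_real (norm y / norm u) * cis (r * angle u y)"
    unfolding z_def by (simp only: cis_conv_exp)
  then show norm: "cmod z = norm y / norm u"
    by (simp add: norm_mult norm_divide)
  have cos: "cos (r * a) = cos a" for a using s(2) by auto
  show Re: "Re z = Re (cinner y u) / (norm u)\<^sup>2"
  proof (cases "y = 0")
    case False
    have "\<bar>Re (cinner y u) / (norm y * norm u)\<bar> \<le> 1"
      using abs_Re_cinner_le[of y u] False assms(1) by (simp add: abs_divide divide_le_eq)
    then have "cos (angle u y) = Re (cinner y u) / (norm y * norm u)"
      using False by (simp add: angle_def cos_arccos_abs)
    then show ?thesis using False by (simp add: z cos power2_eq_square)
  qed (simp add: z)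
  \<comment> \<open>The sine of the angle is therefore nonnegative, and only the sign
    \<open>r\<close> decides the sign of \<open>Im z\<close>.\<close>
  have "0 \<le> angle u y" "angle u y \<le> pi"
    using abs_Re_cinner_le[of y u] assms(1)
    by (auto simp: angle_def intro!: arccos_lbound arccos_ubound simp: abs_le_iff divide_simps)
  then have "0 \<le> sin (angle u y)" by (rule sin_ge_zero)
  then have "0 \<le> r * Im z" using s(2) by (auto simp: z)
  moreover have "(Im z)\<^sup>2 = (norm y)\<^sup>2 / (norm u)\<^sup>2 - (Re z)\<^sup>2"
    using cmod_power2[of z] norm by (simp add: power_divide)
  ultimately show "Im z = Re s * sqrt ((norm y)\<^sup>2 / (norm u)\<^sup>2 - (Re z)\<^sup>2)"
    using s(2) by (auto simp: s(1) abs_if split: if_splits simp flip: \<open>(Im z)\<^sup>2 = _\<close>)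
qed

lemma cmod_diff_of_real_power2:
  "(cmod (z - of_real a))\<^sup>2 = (cmod z)\<^sup>2 - 2 * a * Re z + a\<^sup>2"
  unfolding cmod_power2 by (simp add: power2_eq_square algebra_simps)

text \<open>The distance from \<alpha> to the point produced by \<open>u\<close> equals the gain of
  T - \<alpha> I at the same \<open>u\<close>, so it lies between the extreme gains.\<close>

lemma SRG_subset_Ann: "SRG D T \<subseteq> Ann D T \<alpha>"
proof
  fix p assume "p \<in> SRG D T"
  then obtain u s where us: "u \<in> D - {0}" "s \<in> {1, - 1 :: complex}" and
    p: "p = Finite (of_real (norm (T u) / norm u) * exp (s * \<i> * of_real (angle u (T u))))"
    unfolding SRG_def by blast
  define z where "z = of_real (norm (T u) / norm u) * exp (s * \<i> * of_real (angle u (T u)))"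
  have u: "u \<noteq> 0" using us by simp
  have "(cmod (z - of_real \<alpha>))\<^sup>2 = (norm (T u - \<alpha> *\<^sub>R u) / norm u)\<^sup>2"
    unfolding cmod_diff_of_real_power2 power_divide power2_norm_diff_scaleR z_def
      SRG_point(1,2)[OF u us(2)]
    using u by (simp add: field_simps power2_eq_square)
  then have eq: "cmod (z - of_real \<alpha>) = norm (T u - \<alpha> *\<^sub>R u) / norm u"
    by (simp add: power2_eq_iff_nonneg)
  have "min_gain D (\<lambda>u. T u - \<alpha> *\<^sub>R u) \<le> ennreal (cmod (z - of_real \<alpha>))"
    unfolding min_gain_def eq by (rule INF_lower[OF us(1)])
  moreover have "ennreal (cmod (z - of_real \<alpha>)) \<le> max_gain D (\<lambda>u. T u - \<alpha> *\<^sub>R u)"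
    unfolding max_gain_def eq by (rule SUP_upper[OF us(1)])
  moreover have "p = Finite (of_real \<alpha> + (z - of_real \<alpha>))" by (simp add: p z_def)
  ultimately show "p \<in> Ann D T \<alpha>" unfolding Ann_def Let_def by blast
qed

text \<open>This inverts z -> (Re z, |z|^2) on either closed half-plane.\<close>

lemma Finite_in_SRG:
  assumes "v \<in> moment_range D T" "s = 1 \<or> s = -1"
  shows "Finite (Complex (Re v) (s * sqrt (Im v - (Re v)\<^sup>2))) \<in> SRG D T"
proof -
  obtain u where u: "u \<in> D" "norm u = 1" "v = moment T u"
    using assms(1) by (auto simp: moment_range_def)
  define z where
    "z = of_real (norm (T u) / norm u) * exp (of_real s * \<i> * of_real (angle u (T u)))"
  have u0: "u \<noteq> 0" and s: "of_real s \<in> {1, - 1 :: complex}" using u assms(2) by auto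
  have "z = Complex (Re v) (s * sqrt (Im v - (Re v)\<^sup>2))"
    using SRG_point[OF u0 s, of "T u", folded z_def] u by (simp add: complex_eq_iff moment_def)
  moreover have "Finite z \<in> SRG D T"
    unfolding SRG_def z_def using u(1) u0 s by blast
  ultimately show ?thesis by simp
qed

text \<open>The infimum over the empty set is infinite and the supremum is 0, so no modulus fits
  between them.\<close>

lemma Ann_trivial: "Ann {0} T \<alpha> = {}"
  by (auto simp: Ann_def min_gain_def max_gain_def top_unique bot_ennreal)

lemma Ann_lower_bound:
  assumes "Finite w \<in> Ann D T \<alpha>" "0 \<le> r"
    and "\<And>u. u \<in> D \<Longrightarrow> u \<noteq> 0 \<Longrightarrow> r \<le> norm (T u - \<alpha> *\<^sub>R u) / norm u"
  shows "r \<le> cmod (w - of_real \<alpha>)"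
proof -
  have "ennreal r \<le> min_gain D (\<lambda>u. T u - \<alpha> *\<^sub>R u)"
    unfolding min_gain_def using assms(3) by (intro INF_greatest ennreal_leI) auto
  also have "\<dots> \<le> ennreal (cmod (w - of_real \<alpha>))"
    using assms(1) by (auto simp: Ann_def Let_def split: if_splits)
  finally show ?thesis by (simp add: ennreal_le_iff)
qed

text \<open>A finite bound on the gains also keeps \<open>Infinity\<close> out of the annulus, which
  is why a finite \<open>w\<close> is obtained.\<close>

lemma Ann_upper_bound:
  assumes "p \<in> Ann D T \<alpha>" "0 \<le> r"
    and "\<And>u. u \<in> D \<Longrightarrow> u \<noteq> 0 \<Longrightarrow> norm (T u - \<alpha> *\<^sub>R u) / norm u \<le> r"
  obtains w where "p = Finite w" "cmod (w - of_real \<alpha>) \<le> r"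
proof -
  have M: "max_gain D (\<lambda>u. T u - \<alpha> *\<^sub>R u) \<le> ennreal r"
    unfolding max_gain_def using assms(3) by (intro SUP_least ennreal_leI) auto
  then have "max_gain D (\<lambda>u. T u - \<alpha> *\<^sub>R u) \<noteq> \<infinity>"
    by (metis ennreal_less_top infinity_ennreal_def leD)
  then obtain z where z: "p = Finite (of_real \<alpha> + z)"
    "ennreal (cmod z) \<le> max_gain D (\<lambda>u. T u - \<alpha> *\<^sub>R u)"
    using assms(1) by (auto simp: Ann_def Let_def)
  have "cmod z \<le> r" using order_trans[OF z(2) M] assms(2) by (simp add: ennreal_le_iff)
  then show ?thesis using z(1) by (intro that[of "of_real \<alpha> + z"]) simp_all
qed

section \<open>Limits in the extended plane\<close>

lemma dist_ext_stereo: "dist x y = dist (stereo x) (stereo y)"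
  by (simp add: dist_ext_complex_def chordal_dist_eq_dist_stereo)

lemma continuous_on_Finite: "continuous_on S Finite"
proof (rule continuous_on_subset[of UNIV])
  show "continuous_on UNIV Finite"
    unfolding continuous_on_def
  proof safe
    fix z
    have "((\<lambda>w. dist (stereo (Finite w)) (stereo (Finite z))) \<longlongrightarrow>
        dist (stereo (Finite z)) (stereo (Finite z))) (at z)"
      unfolding stereo.simps using one_plus_sq_pos
      by (intro tendsto_intros) (auto simp: add_nonneg_eq_0_iff)
    then show "(Finite \<longlongrightarrow> Finite z) (at z)"
      by (subst tendsto_dist_iff) (simp only: dist_ext_stereo dist_self)
  qed
qed simp

lemma tendsto_Finite_D:
  assumes "x \<longlonglongrightarrow> Finite z"
  obtains w where "w \<longlonglongrightarrow> z" "\<forall>\<^sub>F n in sequentially. x n = Finite (w n)"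
proof -
  \<comment> \<open>This is inverse stereographic projection. Height below 1 characterises the
    finite points, and it persists near the limit.\<close>
  define f where "f p = (1 / (1 - snd (stereo p))) *\<^sub>R fst (stereo p)" for p
  have height: "1 - snd (stereo (Finite w)) = 2 / (1 + (cmod w)\<^sup>2)" for w
    using one_plus_sq_pos[of "cmod w"] by (simp add: field_simps)
  have lt: "snd (stereo (Finite w)) < 1" for w
    using height[of w] one_plus_sq_pos[of "cmod w"] by (smt (verit) divide_pos_pos)
  have f: "f (Finite w) = w" for w
  proof -
    have *: "1 / (2 / p) * (2 / p) = 1" if "p > 0" for p :: real using that by simp
    show ?thesis
      unfolding f_def height
      by (simp only: stereo.simps fst_conv scaleR_scaleR *[OF one_plus_sq_pos] scaleR_one)
  qed
  have st: "(\<lambda>n. stereo (x n)) \<longlonglongrightarrow> stereo (Finite z)"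
    using iffD1[OF tendsto_dist_iff assms]
    by (subst tendsto_dist_iff) (simp only: dist_ext_stereo)
  have "(\<lambda>n. f (x n)) \<longlonglongrightarrow> f (Finite z)"
    unfolding f_def using lt[of z] by (intro tendsto_intros st) auto
  moreover have "\<forall>\<^sub>F n in sequentially. snd (stereo (x n)) < 1"
    by (rule order_tendstoD(2)[OF tendsto_snd[OF st] lt])
  then have "\<forall>\<^sub>F n in sequentially. x n = Finite (f (x n))"
  proof eventually_elim
    case (elim n)
    then show ?case by (cases "x n") (simp_all add: f del: stereo.simps(1))
  qed
  ultimately show ?thesis using that by (simp only: f)
qed

lemma dist_Infinity_Finite: "dist Infinity (Finite w) = 2 / sqrt (1 + (cmod w)\<^sup>2)"
  by (simp add: dist_ext_complex_def)

lemma set_lim_mono: "(\<And>k. S k \<subseteq> S' k) \<Longrightarrow> set_lim S \<subseteq> set_lim S'"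
  unfolding set_lim_def by blast

lemma closure_subset_set_lim:
  assumes "incseq S" "S 0 \<noteq> {}"
  shows "closure (\<Union>k. S k) \<subseteq> set_lim S"
proof
  fix z assume z: "z \<in> closure (\<Union>k. S k)"
  have ne: "S k \<noteq> {}" for k using assms incseqD[OF assms(1), of 0 k] by auto
  \<comment> \<open>The distance to \<open>S k\<close> need not be attained; the vanishing slack
    yields a near-minimiser in every \<open>S k\<close>.\<close>
  have "\<exists>x. x \<in> S k \<and> dist z x < infdist z (S k) + inverse (real (Suc k))" for k
  proof -
    have "Inf ((\<lambda>a. dist z a) ` S k) < infdist z (S k) + inverse (real (Suc k))"
      using ne[of k] by (simp add: infdist_notempty)
    then show ?thesis using ne[of k] by (subst (asm) cInf_less_iff) (auto intro: bdd_belowI2[of _ 0])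
  qed
  then obtain x where x: "\<And>k. x k \<in> S k"
    "\<And>k. dist z (x k) < infdist z (S k) + inverse (real (Suc k))"
    by metis
  have "(\<lambda>k. infdist z (S k)) \<longlonglongrightarrow> 0"
  proof (rule order_tendstoI)
    fix e :: real assume "0 < e"
    then have "\<exists>y \<in> (\<Union>k. S k). dist y z < e"
      using z unfolding closure_approachable by blast
    then obtain N y where y: "y \<in> S N" "dist z y < e" by (auto simp: dist_commute)
    have "infdist z (S k) < e" if "k \<ge> N" for k
      using infdist_le[of y "S k" z] incseqD[OF assms(1) that] y by (meson le_less_trans subsetD)
    then show "\<forall>\<^sub>F k in sequentially. infdist z (S k) < e"
      unfolding eventually_sequentially by blast
  next
    fix e :: real assume "e < 0"
    then show "\<forall>\<^sub>F k in sequentially. e < infdist z (S k)"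
      by (intro always_eventually allI less_le_trans[OF _ infdist_nonneg])
  qed
  then have "(\<lambda>k. infdist z (S k) + inverse (real (Suc k))) \<longlonglongrightarrow> 0 + 0"
    by (intro tendsto_add LIMSEQ_inverse_real_of_nat)
  then have lim: "(\<lambda>k. infdist z (S k) + inverse (real (Suc k))) \<longlonglongrightarrow> 0" by simp
  have "(\<lambda>k. dist z (x k)) \<longlonglongrightarrow> 0"
  proof (rule tendsto_sandwich[OF _ _ tendsto_const lim])
    show "\<forall>\<^sub>F k in sequentially. dist z (x k) \<le> infdist z (S k) + inverse (real (Suc k))"
      using x(2) by (intro always_eventually allI less_imp_le)
  qed simp
  then have "x \<longlonglongrightarrow> z" by (subst tendsto_dist_iff) (simp add: dist_commute)
  then show "z \<in> set_lim S" using x(1) by (auto simp: set_lim_def)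
qed

section \<open>Increasing sequences of operators\<close>

lemma incseq_convex_Union:
  assumes "incseq W" "\<And>k. convex (W k)"
  shows "convex (\<Union>k. W k)"
proof (rule convexI, clarsimp)
  fix x y i j and u v :: real
  assume "x \<in> W i" "y \<in> W j" "0 \<le> u" "0 \<le> v" "u + v = 1"
  then have "u *\<^sub>R x + v *\<^sub>R y \<in> W (max i j)"
    using incseqD[OF assms(1), of i "max i j"] incseqD[OF assms(1), of j "max i j"]
    by (intro convexD[OF assms(2)]) auto
  then show "\<exists>k. u *\<^sub>R x + v *\<^sub>R y \<in> W k" ..
qed

text \<open>Only a line with \<open>b \<noteq> 0\<close> corresponds to a circle centred on the real
  axis, that is, to a bound on some annulus.\<close>

lemma nonvertical_separation:
  assumes "convex W" "p \<notin> closure W" "\<And>v. v \<in> W \<Longrightarrow> 0 \<le> Im v" "0 \<le> Im p"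
  obtains a b c :: real where "b \<noteq> 0" "a * Re p + b * Im p < c"
    "\<And>v. v \<in> W \<Longrightarrow> c < a * Re v + b * Im v"
proof -
  obtain n c where n: "inner n p < c" "\<And>v. v \<in> closure W \<Longrightarrow> c < inner n v"
    using separating_hyperplane_closed_point[of "closure W" p] assms
    by (auto simp: convex_closure)
  have n1: "Re n * Re p + Im n * Im p < c"
    and n2: "\<And>v. v \<in> W \<Longrightarrow> c < Re n * Re v + Im n * Im v"
    using n closure_subset[of W] by (auto simp: inner_complex_def)
  show ?thesis
  proof (cases "Im n = 0")
    case False
    then show ?thesis using that n1 n2 by blast
  next
    case True
    \<comment> \<open>Tilting by \<open>d > 0\<close> cannot hurt on \<open>W\<close>, where
      \<open>Im\<close> is nonnegative. The added 1 makes \<open>d * Im p\<close> strictly smaller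
      than the gap at \<open>p\<close>, even if \<open>Im p = 0\<close>.\<close>
    define d where "d = (c - Re n * Re p) / (Im p + 1)"
    have "Re n * Re p < c" using n1 True by simp
    then have d: "d > 0" "d * Im p < c - Re n * Re p"
      using assms(4) by (simp_all add: d_def field_simps)
    show ?thesis
    proof (rule that[of d "Re n" c])
      fix v assume v: "v \<in> W"
      have "0 \<le> d * Im v" using d assms(3)[OF v] by simp
      then show "c < Re n * Re v + d * Im v" using n2[OF v] True by simp
    qed (use d in simp_all)
  qed
qed

text \<open>The gain is invariant under scaling, so \<open>u\<close> may be normalised before
  expanding the norm.\<close>

lemma power2_gain_eq_moment:
  assumes "linear_operator D T" "u \<in> D" "u \<noteq> 0"
  obtains v where "v \<in> moment_range D T"
    "(norm (T u - \<alpha> *\<^sub>R u) / norm u)\<^sup>2 = Im v - 2 * \<alpha> * Re v + \<alpha>\<^sup>2"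
proof -
  define w where "w = of_real (1 / norm u) *\<^sub>C u"
  have Tw: "T w = of_real (1 / norm u) *\<^sub>C T u" and w: "w \<in> D" "norm w = 1"
    using assms by (auto simp: linear_operator_def w_def norm_scaleC norm_divide
        intro: complex_vector.subspace_scale)
  have "T w - \<alpha> *\<^sub>R w = (1 / norm u) *\<^sub>R (T u - \<alpha> *\<^sub>R u)"
    unfolding Tw unfolding w_def scaleR_scaleC[symmetric] by (simp add: algebra_simps)
  then have "norm (T u - \<alpha> *\<^sub>R u) / norm u = norm (T w - \<alpha> *\<^sub>R w)" by simp
  then have "(norm (T u - \<alpha> *\<^sub>R u) / norm u)\<^sup>2 =
      Im (moment T w) - 2 * \<alpha> * Re (moment T w) + \<alpha>\<^sup>2"
    using w by (simp add: power2_norm_diff_scaleR moment_def)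
  then show ?thesis using w that by (auto simp: moment_range_def)
qed

theorem theorem2:
  fixes D :: "nat \<Rightarrow> 'a::complex_hilbert_space set"
    and T :: "nat \<Rightarrow> 'a \<Rightarrow> 'a"
  assumes linear: "\<And>k. linear_operator (D k) (T k)"
    and closed: "\<And>k. closed_operator (D k) (T k)"
    and increasing: "\<And>k. op_graph (D k) (T k) \<subseteq> op_graph (D (Suc k)) (T (Suc k))"
  shows "set_lim (\<lambda>k. SRG (D k) (T k)) =
    (\<Inter>\<alpha>::real. set_lim (\<lambda>k. Ann (D k) (T k) \<alpha>))"
proof
  show "set_lim (\<lambda>k. SRG (D k) (T k)) \<subseteq> (\<Inter>\<alpha>. set_lim (\<lambda>k. Ann (D k) (T k) \<alpha>))"
    by (intro INT_greatest set_lim_mono SRG_subset_Ann)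
next
  define S where "S k = SRG (D k) (T k)" for k
  define W where "W k = moment_range (D k) (T k)" for k
  have step: "u \<in> D (Suc k)" "T (Suc k) u = T k u" if "u \<in> D k" for u k
    using increasing[of k] that by (auto simp: op_graph_def)
  have "incseq S"
    unfolding S_def by (intro incseq_SucI) (force simp: SRG_def step)
  have "incseq W"
    unfolding W_def by (intro incseq_SucI) (force simp: moment_range_def moment_def step)
  then have convex: "convex (\<Union>k. W k)"
    by (rule incseq_convex_Union) (simp add: W_def convex_moment_range linear)
  show "(\<Inter>\<alpha>. set_lim (\<lambda>k. Ann (D k) (T k) \<alpha>)) \<subseteq> set_lim (\<lambda>k. SRG (D k) (T k))"
  proof
    fix p assume p: "p \<in> (\<Inter>\<alpha>. set_lim (\<lambda>k. Ann (D k) (T k) \<alpha>))"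
    have seq: "\<exists>x. (\<forall>k. x k \<in> Ann (D k) (T k) \<alpha>) \<and> x \<longlonglongrightarrow> p" for \<alpha>
      using p by (auto simp: set_lim_def)
    \<comment> \<open>A nontrivial \<open>D 0\<close> makes \<open>S 0\<close> nonempty, so that
      points of the closure can be approached from every \<open>S k\<close>.\<close>
    have "D 0 \<noteq> {0}" using seq[of 0] by (metis Ann_trivial empty_iff)
    moreover have "0 \<in> D 0"
      using linear[of 0] by (auto simp: linear_operator_def complex_vector.subspace_0)
    ultimately obtain u0 where u0: "u0 \<in> D 0" "u0 \<noteq> 0" by blast
    then have "S 0 \<noteq> {}" unfolding S_def SRG_def by blast
    have "p \<in> closure (\<Union>k. S k)"
    proof (cases p)
      case (Finite z)
      define v0 where "v0 = Complex (Re z) ((cmod z)\<^sup>2)"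
      have v0: "v0 \<in> closure (\<Union>k. W k)"
      proof (rule ccontr)
        assume "v0 \<notin> closure (\<Union>k. W k)"
        then obtain a b c :: real where b: "b \<noteq> 0" and lt: "a * Re v0 + b * Im v0 < c"
          and gt: "\<And>v. v \<in> (\<Union>k. W k) \<Longrightarrow> c < a * Re v + b * Im v"
          by (rule nonvertical_separation[OF convex])
            (auto simp: W_def moment_range_def moment_def v0_def)
        \<comment> \<open>This centre makes \<open>a * Re v + b * Im v\<close> equal to
          \<open>b * h v\<close> up to a constant. The separating line becomes the circle of squared
          radius \<open>r\<close>, and \<open>h v0\<close> is the squared distance from
          \<open>z\<close> to the centre.\<close>
        define \<alpha> where "\<alpha> = - a / (2 * b)"
        define r where "r = c / b + \<alpha>\<^sup>2"
        define h where "h v = Im v - 2 * \<alpha> * Re v + \<alpha>\<^sup>2" for v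
        have h: "a * Re v + b * Im v - c = b * (h v - r)" for v
          using b by (simp add: h_def r_def \<alpha>_def field_simps)
        have hz: "(cmod (z - of_real \<alpha>))\<^sup>2 = h v0"
          unfolding cmod_diff_of_real_power2 by (simp add: h_def v0_def)
        have gain: "\<exists>v \<in> (\<Union>k. W k). (norm (T k u - \<alpha> *\<^sub>R u) / norm u)\<^sup>2 = h v"
          if u: "u \<in> D k" "u \<noteq> 0" for k u
        proof -
          obtain v where "v \<in> W k" "(norm (T k u - \<alpha> *\<^sub>R u) / norm u)\<^sup>2 = h v"
            unfolding h_def W_def by (rule power2_gain_eq_moment[OF linear u])
          then show ?thesis by blast
        qed
        have neg: "b * (h v0 - r) < 0" using lt unfolding h[symmetric] by simp
        have pos: "0 < b * (h v - r)" if "v \<in> (\<Union>k. W k)" for v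
          using gt[OF that] unfolding h[symmetric] by simp
        obtain x where x: "\<And>k. x k \<in> Ann (D k) (T k) \<alpha>" "x \<longlonglongrightarrow> Finite z"
          using seq[of \<alpha>] Finite by blast
        obtain w where w: "w \<longlonglongrightarrow> z" and ev: "\<forall>\<^sub>F n in sequentially. x n = Finite (w n)"
          using tendsto_Finite_D[OF x(2)] .
        have lim: "(\<lambda>n. cmod (w n - of_real \<alpha>)) \<longlonglongrightarrow> cmod (z - of_real \<alpha>)"
          by (intro tendsto_intros w)
        show False
        proof (cases "b > 0")
          case True
          \<comment> \<open>Here \<open>z\<close> lies strictly inside the circle while every gain
            is at least \<open>sqrt r\<close>, so no sequence from the annuli reaches
            \<open>z\<close>.\<close>
          have r: "h v0 < r" and *: "\<And>v. v \<in> (\<Union>k. W k) \<Longrightarrow> r < h v"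
            using neg pos True by (simp_all add: mult_less_0_iff zero_less_mult_iff)
          have r0: "0 \<le> r" using r unfolding hz[symmetric] by (rule order_trans[OF zero_le_power2 less_imp_le])
          have "sqrt r \<le> norm (T k u - \<alpha> *\<^sub>R u) / norm u" if u: "u \<in> D k" "u \<noteq> 0" for k u
          proof -
            obtain v where "v \<in> (\<Union>k. W k)" "(norm (T k u - \<alpha> *\<^sub>R u) / norm u)\<^sup>2 = h v"
              using gain[OF u] by blast
            then show ?thesis using *[of v] by (intro real_le_lsqrt) simp_all
          qed
          then have "sqrt r \<le> cmod (w n - of_real \<alpha>)" if "x n = Finite (w n)" for n
            using x(1)[of n] r0 unfolding that by (intro Ann_lower_bound) auto
          then have "\<forall>\<^sub>F n in sequentially. sqrt r \<le> cmod (w n - of_real \<alpha>)"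
            using ev by (auto elim: eventually_mono)
          then have "sqrt r \<le> cmod (z - of_real \<alpha>)"
            by (intro tendsto_lowerbound[OF lim]) simp_all
          then have "r \<le> (cmod (z - of_real \<alpha>))\<^sup>2" using r0 by (simp add: sqrt_le_D)
          then show False using r hz by simp
        next
          case False
          then have "b < 0" using b by simp
          \<comment> \<open>Now the inequalities reverse: \<open>z\<close> lies strictly outside and
            every gain is at most \<open>sqrt r\<close>. Nonnegativity of \<open>r\<close> comes
            from the gain at \<open>u0\<close>.\<close>
          then have r: "r < h v0" and *: "\<And>v. v \<in> (\<Union>k. W k) \<Longrightarrow> h v < r"
            using neg pos by (simp_all add: mult_less_0_iff zero_less_mult_iff)
          have r0: "0 \<le> r" using gain[OF u0] * by (metis less_imp_le order_trans zero_le_power2)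
          have le: "norm (T k u - \<alpha> *\<^sub>R u) / norm u \<le> sqrt r" if u: "u \<in> D k" "u \<noteq> 0" for k u
          proof -
            obtain v where "v \<in> (\<Union>k. W k)" "(norm (T k u - \<alpha> *\<^sub>R u) / norm u)\<^sup>2 = h v"
              using gain[OF u] by blast
            then show ?thesis using *[of v] by (intro real_le_rsqrt) simp
          qed
          have "\<forall>\<^sub>F n in sequentially. cmod (w n - of_real \<alpha>) \<le> sqrt r"
            using ev
          proof eventually_elim
            case (elim n)
            show ?case
              by (rule Ann_upper_bound[OF x(1)[of n], of "sqrt r"]) (use le r0 elim in auto)
          qed
          then have "cmod (z - of_real \<alpha>) \<le> sqrt r"
            by (intro tendsto_upperbound[OF lim]) simp_all
          then have "(cmod (z - of_real \<alpha>))\<^sup>2 \<le> r"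
            using r0 by (metis norm_ge_zero power_mono real_sqrt_pow2)
          then show False using r hz by simp
        qed
      qed
      define s :: real where "s = (if 0 \<le> Im z then 1 else - 1)"
      \<comment> \<open>\<open>f\<close> maps moments to graph points in the half-plane of
        \<open>z\<close>. Real \<open>sqrt\<close> is continuous on the whole line, so
        \<open>f\<close> is continuous everywhere and carries closure into closure.\<close>
      define f where "f v = Finite (Complex (Re v) (s * sqrt (Im v - (Re v)\<^sup>2)))" for v
      have "continuous_on A f" for A
        unfolding f_def
        by (intro continuous_on_compose2[OF continuous_on_Finite[of UNIV]])
          (auto simp: Complex_eq intro!: continuous_intros)
      then have "f ` closure (\<Union>k. W k) \<subseteq> closure (\<Union>k. S k)"
      proof (rule image_closure_subset)
        have "f v \<in> S k" if "v \<in> W k" for v k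
          using that unfolding f_def S_def W_def by (rule Finite_in_SRG) (simp add: s_def)
        then show "f ` (\<Union>k. W k) \<subseteq> closure (\<Union>k. S k)"
          by (intro image_subsetI subsetD[OF closure_subset]) blast
      qed simp
      moreover have "f v0 = p"
        unfolding f_def v0_def Finite by (simp add: s_def cmod_power2 complex_eq_iff)
      ultimately show ?thesis using v0 by blast
    next
      case Infinity
      obtain x where x: "\<And>k. x k \<in> Ann (D k) (T k) 0" "x \<longlonglongrightarrow> Infinity"
        using seq[of 0] Infinity by blast
      \<comment> \<open>If \<open>R\<close> bounded all gains, every annulus at 0 would lie in the
        disc of radius \<open>R\<close>, at a fixed positive chordal distance from
        \<open>Infinity\<close>.\<close>
      have unbounded: "\<exists>k. \<exists>u \<in> D k - {0}. R < norm (T k u) / norm u" if "R \<ge> 0" for R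
      proof (rule ccontr)
        assume "\<not> ?thesis"
        then have le: "norm (T k u - 0 *\<^sub>R u) / norm u \<le> R" if "u \<in> D k" "u \<noteq> 0" for k u
          using that by (auto simp: not_less)
        have "2 / sqrt (1 + R\<^sup>2) \<le> dist (x n) Infinity" for n
        proof (rule Ann_upper_bound[OF x(1)[of n] that])
          fix w assume w: "x n = Finite w" "cmod (w - of_real 0) \<le> R"
          then have "sqrt (1 + (cmod w)\<^sup>2) \<le> sqrt (1 + R\<^sup>2)" by (simp add: power_mono)
          then show ?thesis
            using one_plus_sq_pos[of "cmod w"] w(1)
            by (auto simp: dist_commute[of _ Infinity] dist_Infinity_Finite intro!: divide_left_mono)
        qed (use le in auto)
        moreover have "(\<lambda>n. dist (x n) Infinity) \<longlonglongrightarrow> 0"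
          using x(2) by (subst (asm) tendsto_dist_iff)
        ultimately have "2 / sqrt (1 + R\<^sup>2) \<le> 0"
          by (intro LIMSEQ_le_const[of "\<lambda>n. dist (x n) Infinity"]) auto
        then show False using one_plus_sq_pos[of R] by (simp add: divide_le_0_iff)
      qed
      show ?thesis
        unfolding closure_approachable Infinity
      proof safe
        fix e :: real assume e: "e > 0"
        \<comment> \<open>The chordal distance from \<open>w\<close> to \<open>Infinity\<close> is
          at most 2/|w|, so modulus above \<open>2 / e\<close> suffices.\<close>
        obtain k u where u: "u \<in> D k - {0}" "2 / e < norm (T k u) / norm u"
          using unbounded[of "2 / e"] e by auto
        define w where
          "w = of_real (norm (T k u) / norm u) * exp (1 * \<i> * of_real (angle u (T k u)))"
        have "Finite w \<in> S k" unfolding S_def SRG_def w_def using u by blast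
        have "cmod w = norm (T k u) / norm u"
          unfolding w_def by (rule SRG_point(2)) (use u in auto)
        then have "2 / e < cmod w" using u by simp
        also have "cmod w \<le> sqrt (1 + (cmod w)\<^sup>2)" by (intro real_le_rsqrt) simp
        finally have "dist Infinity (Finite w) < e"
          using e one_plus_sq_pos[of "cmod w"] by (simp add: dist_Infinity_Finite field_simps)
        then show "\<exists>y \<in> (\<Union>k. S k). dist y Infinity < e"
          using \<open>Finite w \<in> S k\<close> unfolding dist_commute[of Infinity] by blast
      qed
    qed
    then show "p \<in> set_lim (\<lambda>k. SRG (D k) (T k))"
      using closure_subset_set_lim[OF \<open>incseq S\<close> \<open>S 0 \<noteq> {}\<close>] unfolding S_def by blast
  qed
qed

end
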